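(* Let $n\geq 2$ and $m\geq 1$ be integers, let $a_{1},\dots,a_{n}>0$ be real numbers, and put $A=\sum_{i=1}^{n}a_{i}$. Define \[ B(n)=\sum_{i=1}^{n}(-1)^{i}\sum_{1\leq j_{1}<j_{2}<\cdots<j_{i}\leq n}\Big[\sum_{k=0}^{n-1}\binom{n-1}{k}\Big(-\sum_{l=1}^{i}a_{j_{l}}\Big)^{n-1-k}\frac{A^{k+m+1}-\big(\sum_{l=1}^{i}a_{j_{l}}\big)^{k+m+1}}{k+m+1}\Big]. \] Then \[ \frac{1}{(n-1)!\prod_{i=1}^{n}a_{i}}\Big[\frac{A^{m+n}}{m+n}+B(n)\Big]=\sum_{i_{1}+\cdots+i_{n}=m}\binom{m}{i_{1},\dots,i_{n}}\frac{a_{1}^{i_{1}}}{i_{1}+1}\cdots\frac{a_{n}^{i_{n}}}{i_{n}+1}, \] where the sum on the right runs over all $n$-tuples of nonnegative integers with $i_1+\cdots+i_n=m$.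
   Context: $\binom{m}{i_1,\dots,i_n}=\frac{m!}{i_1!\cdots i_n!}$ is the multinomial coefficient; the convention $0^0=1$ is used. *)

theory Defs
  imports "HOL-Analysis.Analysis"
begin

definition multinomial :: "nat \<Rightarrow> nat \<Rightarrow> (nat \<Rightarrow> nat) \<Rightarrow> real" where
  "multinomial m n i = fact m / (\<Prod>l=1..n. fact (i l))"

text \<open>The strictly increasing index sequences \<open>1 \<le> j 1 < \<dots> < j i \<le> n\<close>. Being extensional
  (fixed outside \<open>{1..i}\<close>), each sequence is represented by exactly one function.\<close>

definition increasing_seqs :: "nat \<Rightarrow> nat \<Rightarrow> (nat \<Rightarrow> nat) set" where
  "increasing_seqs i n = {j \<in> {1..i} \<rightarrow>\<^sub>E {1..n}. strict_mono_on {1..i} j}"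

text \<open>The \<open>n\<close>-tuples of nonnegative integers with sum \<open>m\<close>, again extensional.\<close>

definition weak_compositions :: "nat \<Rightarrow> nat \<Rightarrow> (nat \<Rightarrow> nat) set" where
  "weak_compositions m n = {i \<in> {1..n} \<rightarrow>\<^sub>E UNIV. (\<Sum>l=1..n. i l) = m}"

definition B :: "(nat \<Rightarrow> real) \<Rightarrow> nat \<Rightarrow> nat \<Rightarrow> real" where
  "B a m n =
    (let A = (\<Sum>i=1..n. a i) in
     \<Sum>i=1..n. (-1) ^ i *
       (\<Sum>j\<in>increasing_seqs i n.
         \<Sum>k=0..n-1. real ((n - 1) choose k) * (- (\<Sum>l=1..i. a (j l))) ^ (n - 1 - k) *
           ((A ^ (k + m + 1) - (\<Sum>l=1..i. a (j l)) ^ (k + m + 1)) / real (k + m + 1))))"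

end

theory Submission
  imports Defs
begin

text \<open>Each bracket in \<open>B(n)\<close> is \<open>F(s) = \<integral>\<^sub>s\<^sup>A (x - s)\<^bsup>n-1\<^esup> x\<^sup>m dx\<close> at a subset sum \<open>s\<close>, and the extra
  term \<open>A\<^bsup>m+n\<^esup>/(m+n)\<close> is \<open>F(0)\<close>, the contribution of the empty subset. As a polynomial in \<open>s\<close>,
  \<open>F\<close> is a Beta value times \<open>(-1)\<^sup>n s\<^bsup>m+n\<^esup>\<close> plus terms of degree less than \<open>n\<close>. The alternating sum of
  \<open>s\<^sup>p\<close> over all subsets is \<open>p!\<close> times the \<open>p\<close>-th coefficient of \<open>\<Prod>\<^sub>l (1 - e\<^bsup>a\<^sub>l t\<^esup>)\<close>; it vanishes for
  \<open>p < n\<close>, and for \<open>p = m + n\<close> it is read off from \<open>\<Prod>\<^sub>l (e\<^bsup>a\<^sub>l t\<^esup> - 1)/t\<close>.\<close>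

section \<open>A finite Beta identity\<close>

text \<open>This is the Beta integral of x^m (1 - x)^N over [0, 1], expanded binomially. Pascal's
  rule splits the sum for \<open>Suc N\<close> into the sum for N at m minus the sum for N at
  \<open>Suc m\<close>, so m has to vary in the induction.\<close>

lemma sum_choose_alternating_div:
  "(\<Sum>k\<le>N. real (N choose k) * (-1) ^ k / real (k + m + 1)) = fact N * fact m / fact (N + m + 1)"
proof (induction N arbitrary: m)
  case 0
  show ?case by simp
next
  case (Suc N)
  let ?t = "\<lambda>M j k. real (M choose j) * (-1) ^ k / real (k + m + 1)"
  have "(\<Sum>k\<le>Suc N. ?t (Suc N) k k) = 1 / real (m + 1) + (\<Sum>k\<le>N. ?t (Suc N) (Suc k) (Suc k))"
    by (subst sum.atMost_Suc_shift) simp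
  also have "(\<Sum>k\<le>N. ?t (Suc N) (Suc k) (Suc k)) = (\<Sum>k\<le>N. ?t N (Suc k) (Suc k)) + (\<Sum>k\<le>N. ?t N k (Suc k))"
    unfolding sum.distrib [symmetric]
    by (intro sum.cong refl) (simp add: add_divide_distrib [symmetric] algebra_simps)
  also have "1 / real (m + 1) + ((\<Sum>k\<le>N. ?t N (Suc k) (Suc k)) + (\<Sum>k\<le>N. ?t N k (Suc k))) =
      (\<Sum>k\<le>Suc N. ?t N k k) + (\<Sum>k\<le>N. ?t N k (Suc k))"
    by (simp only: sum.atMost_Suc_shift [of "\<lambda>k. ?t N k k"]) simp
  also have "(\<Sum>k\<le>Suc N. ?t N k k) = (\<Sum>k\<le>N. ?t N k k)"
    by simp
  also have "(\<Sum>k\<le>N. ?t N k (Suc k)) =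
      - (\<Sum>k\<le>N. real (N choose k) * (-1) ^ k / real (k + Suc m + 1))"
    by (simp add: sum_negf [symmetric])
  \<comment> \<open>The difference of the two values is N! m! / (N + m + 2)! times (N + m + 2) - (m
    + 1) = N + 1.\<close>
  finally show ?case
    unfolding Suc.IH by (simp add: divide_simps) (simp add: algebra_simps)
qed

section \<open>Alternating sums over subsets via exponential series\<close>

text \<open>Multiplying out the product chooses, for each subset S, the term -e^(a_l t) for l in S
  and 1 elsewhere. This gives (-1)^|S| times the exponential series of \<open>sum a S\<close>, whose
  p-th coefficient is \<open>sum a S ^ p / fact p\<close>.\<close>

lemma alternating_sum_power_subset_sums:
  fixes a :: "'a \<Rightarrow> real"
  assumes "finite V"
  shows "(\<Sum>S\<in>Pow V. (-1) ^ card S * sum a S ^ p) = fact p * fps_nth (\<Prod>l\<in>V. 1 - fps_exp (a l)) p"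
proof -
  have exp_sum: "(\<Prod>l\<in>S. fps_exp (a l)) = fps_exp (sum a S)" if "finite S" for S
    using that by induction (simp_all add: fps_exp_add_mult)
  have "fps_nth (\<Prod>l\<in>V. 1 - fps_exp (a l)) p = (\<Sum>S\<in>Pow V. fps_nth ((-1) ^ card S * fps_exp (sum a S)) p)"
    using assms by (simp add: prod_diff_conv_sum fps_sum_nth exp_sum finite_subset)
  also have "\<dots> = (\<Sum>S\<in>Pow V. (-1) ^ card S * (sum a S ^ p / fact p))"
    by (intro sum.cong refl) (simp add: minus_one_power_iff)
  finally show ?thesis
    by (simp add: sum_distrib_left)
qed

text \<open>Each factor has zero constant term, so -t can be taken out of it; the product is then
  (-t)^|V| times a power series, and its coefficients are shifted by \<open>card V\<close>.\<close>

lemma prod_one_minus_fps_exp_nth: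
  fixes a :: "'a \<Rightarrow> real"
  shows "fps_nth (\<Prod>l\<in>V. 1 - fps_exp (a l)) p =
    (if p < card V then 0
     else (-1) ^ card V * fps_nth (\<Prod>l\<in>V. Abs_fps (\<lambda>i. a l ^ (i + 1) / fact (i + 1))) (p - card V))"
proof -
  have factor: "1 - fps_exp c = - fps_X * Abs_fps (\<lambda>i. c ^ (i + 1) / fact (i + 1))" for c :: real
  proof (rule fps_ext)
    fix k
    show "fps_nth (1 - fps_exp c) k = fps_nth (- fps_X * Abs_fps (\<lambda>i. c ^ (i + 1) / fact (i + 1))) k"
      by (cases k) (simp_all add: fps_X_mult_nth algebra_simps)
  qed
  have "(\<Prod>l\<in>V. 1 - fps_exp (a l)) =
      (-1) ^ card V * (fps_X ^ card V * (\<Prod>l\<in>V. Abs_fps (\<lambda>i. a l ^ (i + 1) / fact (i + 1))))"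
    unfolding factor prod.distrib
    by (simp only: prod_constant power_minus [of fps_X] mult.assoc)
  moreover have "fps_nth ((-1) ^ k * f) p = (-1) ^ k * fps_nth f p" for k and f :: "real fps"
    by (simp add: minus_one_power_iff)
  ultimately show ?thesis
    by (simp add: fps_X_power_mult_nth)
qed

text \<open>The left-hand side is \<open>\<integral>\<^sub>s\<^sup>A (x - s)\<^sup>N x\<^sup>m dx\<close>; only the last term has degree above \<open>N\<close> in \<open>s\<close>.\<close>
lemma bracket_as_polynomial:
  fixes A s :: real
  shows "(\<Sum>k\<le>N. real (N choose k) * (- s) ^ (N - k) *
      ((A ^ (k + m + 1) - s ^ (k + m + 1)) / real (k + m + 1))) =
    (\<Sum>k\<le>N. real (N choose k) * (-1) ^ (N - k) * A ^ (k + m + 1) / real (k + m + 1) * s ^ (N - k)) -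
    (-1) ^ N * (fact N * fact m / fact (N + m + 1)) * s ^ (N + m + 1)"
proof -
  have "real (N choose k) * (- s) ^ (N - k) * ((A ^ (k + m + 1) - s ^ (k + m + 1)) / real (k + m + 1)) =
      real (N choose k) * (-1) ^ (N - k) * A ^ (k + m + 1) / real (k + m + 1) * s ^ (N - k) -
      (-1) ^ N * s ^ (N + m + 1) * (real (N choose k) * (-1) ^ k / real (k + m + 1))" if "k \<le> N" for k
  proof -
    have "(- s) ^ (N - k) = (-1) ^ (N - k) * s ^ (N - k)"
      by (rule power_minus)
    moreover have "(-1 :: real) ^ (N - k) = (-1) ^ N * (-1) ^ k"
      using that by (auto simp: le_iff_add power_add mult.assoc simp flip: power_mult_distrib)
    moreover have "s ^ (N + m + 1) = s ^ (N - k) * s ^ (k + m + 1)"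
      using that by (simp add: power_add [symmetric])
    ultimately show ?thesis
      by (simp only: right_diff_distrib diff_divide_distrib times_divide_eq_right times_divide_eq_left mult_ac)
  qed
  then show ?thesis
    unfolding sum_choose_alternating_div [symmetric]
    by (simp add: sum_subtractf sum_distrib_left mult_ac)
qed

text \<open>The alternating subset sum is applied to the polynomial form of the bracket. Powers up
  to N vanish because N < \<open>card V\<close>, so A drops out and only the power N + m + 1
  contributes.\<close>

lemma alternating_sum_brackets:
  fixes a :: "'a \<Rightarrow> real"
  assumes "finite V" and card: "card V = Suc N"
  shows "(\<Sum>S\<in>Pow V. (-1) ^ card S *
      (\<Sum>k\<le>N. real (N choose k) * (- sum a S) ^ (N - k) *
        ((A ^ (k + m + 1) - sum a S ^ (k + m + 1)) / real (k + m + 1)))) =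
    fact N * fact m * fps_nth (\<Prod>l\<in>V. Abs_fps (\<lambda>i. a l ^ (i + 1) / fact (i + 1))) m"
    (is "?L = _ * ?c")
proof -
  define d where "d k = real (N choose k) * (-1) ^ (N - k) * A ^ (k + m + 1) / real (k + m + 1)" for k
  define \<beta> :: real where "\<beta> = fact N * fact m / fact (N + m + 1)"
  define P where "P p = (\<Sum>S\<in>Pow V. (-1) ^ card S * sum a S ^ p)" for p
  have P_low: "P p = 0" if "p \<le> N" for p
    using that assms by (simp add: P_def alternating_sum_power_subset_sums prod_one_minus_fps_exp_nth)
  \<comment> \<open>The surviving index is (N + m + 1) - \<open>card V\<close> = m.\<close>
  have P_top: "P (N + m + 1) = fact (N + m + 1) * ((-1) ^ Suc N * ?c)"
    unfolding P_def alternating_sum_power_subset_sums [OF assms(1)] prod_one_minus_fps_exp_nth card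
    by (simp del: fact_Suc)
  have "?L = (\<Sum>S\<in>Pow V. (\<Sum>k\<le>N. d k * ((-1) ^ card S * sum a S ^ (N - k))) -
      (-1) ^ N * \<beta> * ((-1) ^ card S * sum a S ^ (N + m + 1)))"
    unfolding bracket_as_polynomial d_def [symmetric] \<beta>_def [symmetric]
    by (simp add: right_diff_distrib sum_distrib_left mult_ac)
  also have "\<dots> = (\<Sum>S\<in>Pow V. \<Sum>k\<le>N. d k * ((-1) ^ card S * sum a S ^ (N - k))) -
      (-1) ^ N * \<beta> * P (N + m + 1)"
    by (simp add: sum_subtractf P_def sum_distrib_left)
  also have "(\<Sum>S\<in>Pow V. \<Sum>k\<le>N. d k * ((-1) ^ card S * sum a S ^ (N - k))) = (\<Sum>k\<le>N. d k * P (N - k))"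
    unfolding P_def sum_distrib_left by (rule sum.swap)
  also have "\<dots> = 0"
    by (simp add: P_low)
  also have "0 - (-1) ^ N * \<beta> * P (N + m + 1) = fact N * fact m * ?c"
    unfolding P_top \<beta>_def by (simp add: minus_one_power_iff del: fact_Suc)
  finally show ?thesis .
qed

section \<open>Increasing sequences as subsets\<close>

lemma bij_betw_increasing_seqs:
  "bij_betw (\<lambda>j. j ` {1..i}) (increasing_seqs i n) {S. S \<subseteq> {1..n} \<and> card S = i}"
proof (rule bij_betw_imageI)
  show "inj_on (\<lambda>j. j ` {1..i}) (increasing_seqs i n)"
  proof (rule inj_onI)
    fix j j'
    assume j: "j \<in> increasing_seqs i n" "j' \<in> increasing_seqs i n" and eq: "j ` {1..i} = j' ` {1..i}"
    have sorted: "sorted_wrt (<) (map h [1..<Suc i])" if "h \<in> increasing_seqs i n" for h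
      using that unfolding sorted_wrt_map
      by (intro sorted_wrt_mono_rel [OF _ sorted_wrt_upt])
         (auto simp: increasing_seqs_def strict_mono_on_def simp del: upt_Suc)
    \<comment> \<open>A finite set has only one strictly sorted enumeration, and both lists
      enumerate the common image.\<close>
    have "map j [1..<Suc i] = map j' [1..<Suc i]"
      using eq j by (intro strict_sorted_equal sorted) (auto simp: atLeastLessThanSuc_atLeastAtMost simp del: upt_Suc)
    then have "\<forall>l\<in>{1..i}. j l = j' l"
      by (auto simp del: upt_Suc)
    then show "j = j'"
      using j unfolding increasing_seqs_def by (auto intro: PiE_ext)
  qed
  show "(\<lambda>j. j ` {1..i}) ` increasing_seqs i n = {S. S \<subseteq> {1..n} \<and> card S = i}"
  proof (intro equalityI subsetI)
    fix S assume "S \<in> (\<lambda>j. j ` {1..i}) ` increasing_seqs i n"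
    then show "S \<in> {S. S \<subseteq> {1..n} \<and> card S = i}"
      by (auto simp: increasing_seqs_def card_image dest: strict_mono_on_imp_inj_on)
  next
    fix S assume "S \<in> {S. S \<subseteq> {1..n} \<and> card S = i}"
    then have S: "S \<subseteq> {1..n}" "card S = i" by auto
    then obtain h where h: "bij_betw h {..<i} S" "strict_mono_on {..<i} h"
      using ex_bij_betw_strict_mono_card [of S] finite_subset [of S] by auto
    \<comment> \<open>The enumeration \<open>h\<close> counts from 0, hence the shift; restricting
      to \<open>{1..i}\<close> makes \<open>j\<close> extensional.\<close>
    define j where "j = (\<lambda>l\<in>{1..i}. h (l - 1))"
    have pred: "(\<lambda>l. l - 1) ` {1..i} = {..<i}"
      by (auto simp: image_iff intro!: bexI [of _ "Suc _"])
    have "j ` {1..i} = h ` (\<lambda>l. l - 1) ` {1..i}"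
      by (auto simp: j_def image_iff)
    also have "\<dots> = S"
      using h by (simp only: pred bij_betw_imp_surj_on)
    finally have img: "j ` {1..i} = S" .
    moreover have "strict_mono_on {1..i} j"
      by (rule strict_mono_onI) (auto simp: j_def intro!: strict_mono_onD [OF h(2)])
    ultimately have "j \<in> increasing_seqs i n"
      using S by (auto simp: increasing_seqs_def j_def)
    with img show "S \<in> (\<lambda>j. j ` {1..i}) ` increasing_seqs i n"
      by blast
  qed
qed

lemma sum_increasing_seqs:
  fixes a :: "nat \<Rightarrow> real" and f :: "real \<Rightarrow> real"
  shows "(\<Sum>j\<in>increasing_seqs i n. f (\<Sum>l=1..i. a (j l))) =
    (\<Sum>S | S \<subseteq> {1..n} \<and> card S = i. f (sum a S))"
proof -
  have "(\<Sum>l=1..i. a (j l)) = sum a (j ` {1..i})" if "j \<in> increasing_seqs i n" for j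
    using that by (simp add: sum.reindex increasing_seqs_def strict_mono_on_imp_inj_on)
  then have "(\<Sum>j\<in>increasing_seqs i n. f (\<Sum>l=1..i. a (j l))) =
      (\<Sum>j\<in>increasing_seqs i n. f (sum a (j ` {1..i})))"
    by simp
  also have "\<dots> = (\<Sum>S | S \<subseteq> {1..n} \<and> card S = i. f (sum a S))"
    by (rule sum.reindex_bij_betw [OF bij_betw_increasing_seqs])
  finally show ?thesis .
qed

text \<open>Subsets are grouped by cardinality. The empty set yields the separate term
  \<open>f 0\<close>, which absorbs the summand standing next to \<open>B\<close> in the
  theorem.\<close>

lemma sum_Pow_by_increasing_seqs:
  fixes a :: "nat \<Rightarrow> real" and f :: "real \<Rightarrow> real"
  shows "(\<Sum>S\<in>Pow {1..n}. (-1) ^ card S * f (sum a S)) =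
    f 0 + (\<Sum>i=1..n. (-1) ^ i * (\<Sum>j\<in>increasing_seqs i n. f (\<Sum>l=1..i. a (j l))))"
proof -
  let ?g = "\<lambda>i. \<Sum>S | S \<subseteq> {1..n} \<and> card S = i. (-1) ^ card S * f (sum a S)"
  have card: "card S \<le> n" if "S \<subseteq> {1..n}" for S
    using card_mono [OF _ that] by simp
  have "(\<Sum>S\<in>Pow {1..n}. (-1) ^ card S * f (sum a S)) =
      (\<Sum>i\<in>{0..n}. \<Sum>S\<in>{S \<in> Pow {1..n}. card S = i}. (-1) ^ card S * f (sum a S))"
    by (rule sum.group [symmetric]) (use card in auto)
  also have "\<dots> = (\<Sum>i=0..n. ?g i)"
    by simp
  also have "\<dots> = ?g 0 + (\<Sum>i=1..n. ?g i)"
    by (subst sum.atLeast_Suc_atMost) simp_all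
  also have "{S. S \<subseteq> {1..n} \<and> card S = 0} = {{}}"
    by (auto dest: finite_subset)
  also have "(\<Sum>i=1..n. ?g i) = (\<Sum>i=1..n. (-1) ^ i * (\<Sum>j\<in>increasing_seqs i n. f (\<Sum>l=1..i. a (j l))))"
    unfolding sum_increasing_seqs by (simp add: sum_distrib_left)
  finally show ?thesis
    by simp
qed

section \<open>Coefficients of products as sums over compositions\<close>

text \<open>A tuple lists the multiplicities of a multiset over \<open>{1..n}\<close>, and its sum
  is the size. This transfers \<open>fps_prod_nth'\<close>, which is indexed by multisets, to
  tuples.\<close>

lemma bij_betw_weak_compositions:
  "bij_betw (\<lambda>X. \<lambda>l\<in>{1..n}. count X l) (multisets_of_size {1..n} m) (weak_compositions m n)"
proof (rule bij_betw_imageI)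
  show "inj_on (\<lambda>X. \<lambda>l\<in>{1..n}. count X l) (multisets_of_size {1..n} m)"
  proof (rule inj_onI, rule multiset_eqI)
    fix X Y l
    assume XY: "X \<in> multisets_of_size {1..n} m" "Y \<in> multisets_of_size {1..n} m"
      and eq: "(\<lambda>l\<in>{1..n}. count X l) = (\<lambda>l\<in>{1..n}. count Y l)"
    show "count X l = count Y l"
    proof (cases "l \<in> {1..n}")
      case True
      then show ?thesis using fun_cong [OF eq, of l] by simp
    next
      case False
      then have "l \<notin># X" "l \<notin># Y"
        using XY unfolding multisets_of_size_def by blast+
      then show ?thesis by (simp add: not_in_iff)
    qed
  qed
  have size: "size X = (\<Sum>l=1..n. count X l)" if "set_mset X \<subseteq> {1..n}" for X
    unfolding size_multiset_overloaded_eq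
    using that by (intro sum.mono_neutral_left) (auto simp: not_in_iff)
  show "(\<lambda>X. \<lambda>l\<in>{1..n}. count X l) ` multisets_of_size {1..n} m = weak_compositions m n"
  proof (intro equalityI subsetI)
    fix i assume "i \<in> (\<lambda>X. \<lambda>l\<in>{1..n}. count X l) ` multisets_of_size {1..n} m"
    then obtain X where X: "set_mset X \<subseteq> {1..n}" "size X = m" and i: "i = (\<lambda>l\<in>{1..n}. count X l)"
      by (auto simp: multisets_of_size_def)
    have "(\<Sum>l=1..n. count X l) = m"
      using size [OF X(1)] X(2) by simp
    then show "i \<in> weak_compositions m n"
      by (simp add: i weak_compositions_def)
  next
    fix i assume i: "i \<in> weak_compositions m n"
    define X where "X = (\<Sum>l=1..n. replicate_mset (i l) l)"
    have count: "count X l = (if l \<in> {1..n} then i l else 0)" for l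
      by (simp add: X_def count_sum)
    have X: "set_mset X \<subseteq> {1..n}"
      by (auto simp: set_mset_def count split: if_splits)
    moreover have "size X = m"
      using i size [OF X] by (simp add: count weak_compositions_def)
    moreover have "i = (\<lambda>l\<in>{1..n}. count X l)"
      using i by (auto simp: count weak_compositions_def PiE_def extensional_def)
    ultimately show "i \<in> (\<lambda>X. \<lambda>l\<in>{1..n}. count X l) ` multisets_of_size {1..n} m"
      by (auto simp: multisets_of_size_def)
  qed
qed

lemma fps_prod_nth_weak_compositions:
  fixes f :: "nat \<Rightarrow> 'a :: comm_semiring_1 fps"
  shows "fps_nth (\<Prod>l=1..n. f l) m = (\<Sum>i\<in>weak_compositions m n. \<Prod>l=1..n. fps_nth (f l) (i l))"
  by (simp add: fps_prod_nth' flip: sum.reindex_bij_betw [OF bij_betw_weak_compositions])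

theorem theorem4p7:
  fixes n m :: nat and a :: "nat \<Rightarrow> real" and A :: real
  assumes "n \<ge> 2" and "m \<ge> 1"
    and "\<And>i. i \<in> {1..n} \<Longrightarrow> a i > 0"
    and "A = (\<Sum>i=1..n. a i)"
  shows "1 / (fact (n - 1) * (\<Prod>i=1..n. a i)) * (A ^ (m + n) / real (m + n) + B a m n) =
    (\<Sum>i\<in>weak_compositions m n. multinomial m n i * (\<Prod>l=1..n. a l ^ i l / real (i l + 1)))"
proof -
  obtain N where n: "n = Suc N"
    using assms(1) by (cases n) auto
  define F where "F s = (\<Sum>k\<le>N. real (N choose k) * (- s) ^ (N - k) *
      ((A ^ (k + m + 1) - s ^ (k + m + 1)) / real (k + m + 1)))" for s
  \<comment> \<open>At s = 0 the factor \<open>(- s) ^ (N - k)\<close> vanishes for k < N and is 0^0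
    = 1 for k = N.\<close>
  have "F 0 = (\<Sum>k\<in>{N}. real (N choose k) * (- 0) ^ (N - k) *
      ((A ^ (k + m + 1) - 0 ^ (k + m + 1)) / real (k + m + 1)))"
    unfolding F_def by (rule sum.mono_neutral_right) auto
  then have F0: "F 0 = A ^ (m + n) / real (m + n)"
    by (simp add: n add_ac)
  have B: "B a m n = (\<Sum>i=1..n. (-1) ^ i * (\<Sum>j\<in>increasing_seqs i n. F (\<Sum>l=1..i. a (j l))))"
    by (simp add: B_def F_def Let_def n assms(4) atLeast0AtMost)
  have "A ^ (m + n) / real (m + n) + B a m n = (\<Sum>S\<in>Pow {1..n}. (-1) ^ card S * F (sum a S))"
    unfolding sum_Pow_by_increasing_seqs F0 B ..
  also have "\<dots> = fact N * fact m * fps_nth (\<Prod>l=1..n. Abs_fps (\<lambda>i. a l ^ (i + 1) / fact (i + 1))) m"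
    unfolding F_def by (rule alternating_sum_brackets) (simp_all add: n)
  also have "\<dots> = fact N * fact m * (\<Sum>i\<in>weak_compositions m n. \<Prod>l=1..n. a l ^ (i l + 1) / fact (i l + 1))"
    by (simp only: fps_prod_nth_weak_compositions fps_nth_Abs_fps)
  also have "\<dots> = fact N * (\<Sum>i\<in>weak_compositions m n.
      (\<Prod>l=1..n. a l) * (multinomial m n i * (\<Prod>l=1..n. a l ^ i l / real (i l + 1))))"
  proof -
    have "fact m * (\<Prod>l=1..n. a l ^ (i l + 1) / fact (i l + 1)) =
        (\<Prod>l=1..n. a l) * (multinomial m n i * (\<Prod>l=1..n. a l ^ i l / real (i l + 1)))" for i :: "nat \<Rightarrow> nat"
    proof -
      \<comment> \<open>From (i + 1)! = (i + 1) i!: the factors i! form the multinomial denominator,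
        and one \<open>a l\<close> per index moves into the prefactor.\<close>
      have "a l ^ (i l + 1) / fact (i l + 1) = a l * (a l ^ i l / real (i l + 1)) / fact (i l)" for l
        by simp
      then show ?thesis
        by (simp only: multinomial_def prod_dividef prod.distrib times_divide_eq_left times_divide_eq_right
            divide_divide_eq_left mult_ac)
    qed
    then show ?thesis
      by (simp only: mult.assoc sum_distrib_left)
  qed
  finally have "A ^ (m + n) / real (m + n) + B a m n = fact (n - 1) * (\<Prod>l=1..n. a l) *
      (\<Sum>i\<in>weak_compositions m n. multinomial m n i * (\<Prod>l=1..n. a l ^ i l / real (i l + 1)))"
    by (simp only: n diff_Suc_1 mult.assoc sum_distrib_left)
  \<comment> \<open>Positivity of the \<open>a l\<close> permits the final division by their
    product.\<close>
  moreover have "(\<Prod>l=1..n. a l) \<noteq> 0"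
    using assms(3) by (fastforce simp: prod_zero_iff)
  ultimately show ?thesis
    by simp
qed

end
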